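(* Fix a real number $a>1$. Let $N_1,N_2\in\mathbb{N}\cup\{0\}$ and let $f\in C_{N_1,N_2}$. Then there exists a positive constant $\mathcal{M}_9=\mathcal{M}_9(N_1,N_2)$ such that, for $m,n\in\mathbb{N}$ and $x,y>0$, $$w_{N_1,N_2}(x,y)\,\bigl\|\hat{Y}_{m,n,a}(f;\cdot,\cdot)-f\bigr\|_{N_1,N_2}\le \mathcal{M}_9(N_1,N_2)\;\omega\bigl(f,C_{N_1,N_2};\delta'_m,\delta'_n\bigr),$$ where $\delta'_m=\delta'_m(x)=\sqrt{\frac{x(1+x)}{m}}$ and $\delta'_n=\delta'_n(y)=\sqrt{\frac{y(1+y)}{n}}$.
   Context: $\mathbb{N}=\{1,2,3,\dots\}$ and $X=[0,\infty)\times[0,\infty)$. Weights: $w_0(x)=1$ and $w_N(x)=(1+x^N)^{-1}$ for $N\in\mathbb{N}$, $x\ge 0$; and $w_{N_1,N_2}(x,y)=w_{N_1}(x)w_{N_2}(y)$. $C_{N_1,N_2}$ is the set of all continuous functions $f:X\to\mathbb{R}$ such that $w_{N_1,N_2}f$ is uniformly continuous and bounded on $X$, with norm $\|f\|_{N_1,N_2}=\sup_{x,y\ge 0}w_{N_1,N_2}(x,y)|f(x,y)|$. Modulus of continuity: for $f\in C_{N_1,N_2}$ and $\delta_1,\delta_2>0$, $$\omega(f,C_{N_1,N_2};\delta_1,\delta_2)=\sup_{0\le h_1\le\delta_1,\ 0\le h_2\le\delta_2}\|\Delta_{h_1,h_2}f\|_{N_1,N_2},\qquad \Delta_{h_1,h_2}f(x,y)=f(x+h_1,y+h_2)-f(x,y).$$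 Operators: for $m,n\in\mathbb{N}$ and $(x,y)\in X$, with $a>1$ fixed, $$\hat{Y}_{m,n,a}(f;x,y)=\sum_{k_1=0}^{\infty}\sum_{k_2=0}^{\infty}a^{\frac{-x}{a^{1/m}-1}}\,a^{\frac{-y}{a^{1/n}-1}}\,\frac{x^{k_1}y^{k_2}(\log a)^{k_1+k_2}}{(a^{1/m}-1)^{k_1}(a^{1/n}-1)^{k_2}\,k_1!\,k_2!}\;f\!\left(\frac{k_1}{m},\frac{k_2}{n}\right),$$ with the convention $0^0=1$.
   Formalization: The norm of Ŷf − f on the left is replaced by the pointwise value |Ŷf(x,y) − f(x,y)|; with the norm the claim is false (N₁=N₂=0, a=2, m=n=1, f=e^{−x}: as x,y→0 the left side stays positive while the right side tends to 0). *)

theory Defs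
  imports "HOL-Analysis.Analysis"
begin

definition quadrant :: "(real \<times> real) set" where
  "quadrant = {0..} \<times> {0..}"

definition weight1 :: "nat \<Rightarrow> real \<Rightarrow> real" where
  "weight1 N x = (if N = 0 then 1 else inverse (1 + x ^ N))"

definition weight :: "nat \<Rightarrow> nat \<Rightarrow> real \<times> real \<Rightarrow> real" where
  "weight N1 N2 = (\<lambda>(x, y). weight1 N1 x * weight1 N2 y)"

(* Functions on the quadrant are represented by total functions on the plane.
   All notions below depend only on the values on the quadrant. *)
definition weighted_space :: "nat \<Rightarrow> nat \<Rightarrow> (real \<times> real \<Rightarrow> real) set" where
  "weighted_space N1 N2 =
     {f. continuous_on quadrant f \<and>
         uniformly_continuous_on quadrant (\<lambda>p. weight N1 N2 p * f p) \<and>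
         bounded ((\<lambda>p. weight N1 N2 p * f p) ` quadrant)}"

definition weighted_norm :: "nat \<Rightarrow> nat \<Rightarrow> (real \<times> real \<Rightarrow> real) \<Rightarrow> real" where
  "weighted_norm N1 N2 f = (SUP p\<in>quadrant. weight N1 N2 p * \<bar>f p\<bar>)"

definition shift_diff :: "real \<Rightarrow> real \<Rightarrow> (real \<times> real \<Rightarrow> real) \<Rightarrow> real \<times> real \<Rightarrow> real" where
  "shift_diff h1 h2 f = (\<lambda>(x, y). f (x + h1, y + h2) - f (x, y))"

(* For f in the weighted space both real suprema involved (the norm of each
   difference, and the supremum over the shifts) are over nonempty bounded sets,
   because the quotient weight p / weight (p + h) is bounded on the quadrant,
   uniformly in h from a bounded set of nonnegative shifts. *)
definition weighted_modulus ::
    "nat \<Rightarrow> nat \<Rightarrow> (real \<times> real \<Rightarrow> real) \<Rightarrow> real \<Rightarrow> real \<Rightarrow> real" where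
  "weighted_modulus N1 N2 f \<delta>1 \<delta>2 =
     (SUP (h1, h2)\<in>{0..\<delta>1} \<times> {0..\<delta>2}. weighted_norm N1 N2 (shift_diff h1 h2 f))"

(* On the weighted space the double series converges absolutely, since f grows
   at most polynomially. *)
definition Y_op ::
    "nat \<Rightarrow> nat \<Rightarrow> real \<Rightarrow> (real \<times> real \<Rightarrow> real) \<Rightarrow> real \<times> real \<Rightarrow> real" where
  "Y_op m n a f = (\<lambda>(x, y).
     \<Sum>k1. \<Sum>k2.
       a powr (- x / (a powr (1 / real m) - 1)) *
       a powr (- y / (a powr (1 / real n) - 1)) *
       (x ^ k1 * y ^ k2 * ln a ^ (k1 + k2) /
         ((a powr (1 / real m) - 1) ^ k1 * (a powr (1 / real n) - 1) ^ k2 * fact k1 * fact k2)) *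
       f (real k1 / real m, real k2 / real n))"

definition delta' :: "nat \<Rightarrow> real \<Rightarrow> real" where
  "delta' m x = sqrt (x * (1 + x) / real m)"

end

theory Submission
  imports Defs
begin

text \<open>
  With \<open>\<lambda> = x ln a / (a powr (1/m) - 1)\<close>, the operator in one variable is the expectation of
  \<open>f(K/m)\<close> for \<open>K\<close> Poisson distributed with mean \<open>\<lambda>\<close>, and \<open>\<lambda>/m\<close> differs from \<open>x\<close> by at most
  \<open>x ln a / m\<close>. Hence the second moment of \<open>K/m - x\<close> is at most a multiple of \<open>x(1+x)/m\<close>. Going
  from \<open>(x,y)\<close> to \<open>(s,t)\<close> first horizontally and then vertically, in steps no longer than
  \<open>\<delta>1, \<delta>2\<close>, bounds \<open>w(x,y) |f(s,t) - f(x,y)|\<close> by the modulus times a product of a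
  function of \<open>s\<close> and a function of \<open>t\<close>. By AM-GM each factor is dominated by a function whose
  expectation involves only the second moment of \<open>K/m - x\<close> and the moment of \<open>K/m\<close> of order
  \<open>2N\<close>, which is \<open>O(1 + x^(2N))\<close> uniformly in \<open>m\<close>.
\<close>

section \<open>Weights\<close>

lemma weight1_pos: "x \<ge> 0 \<Longrightarrow> weight1 N x > 0"
  by (auto simp: weight1_def add_pos_nonneg)

lemma weight1_antimono:
  assumes "0 \<le> x" "x \<le> y"
  shows "weight1 N y \<le> weight1 N x"
  using assms by (auto simp: weight1_def add_pos_nonneg power_mono intro!: le_imp_inverse_le)

lemma inverse_weight1_le:
  assumes "x \<ge> 0"
  shows "inverse (weight1 N x) \<le> 1 + x ^ N"
  using assms by (auto simp: weight1_def)

text \<open>Cancels the growth of the moment of order \<open>2 * N\<close> in the final average. The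
  constant is 2 because of \<open>N = 0\<close>, where the weight is 1 and
  \<open>1 + x ^ 0 = 2\<close>.\<close>

lemma weight1_sq_le:
  assumes "x \<ge> 0"
  shows "(weight1 N x)\<^sup>2 * (1 + x ^ (2 * N)) \<le> 2"
proof (cases "N = 0")
  case False
  have p: "1 + x ^ N > 0"
    using assms by (simp add: add_pos_nonneg)
  have "1 + x ^ (2 * N) \<le> 2 * (1 + x ^ N)\<^sup>2"
    using assms by (simp add: power2_sum power_mult mult.commute[of 2 N])
  then show ?thesis
    using False p by (simp add: weight1_def field_simps)
qed (simp add: weight1_def)

text \<open>Here \<open>(x + h) ^ N\<close> is at most \<open>(2 * max x d) ^ N\<close>, and the
  power of the maximum is at most the sum of the two powers. The factor depends on \<open>d\<close>;
  it serves to show that the suprema are finite and does not enter the final constant.\<close>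

lemma weight1_shift_le:
  assumes "0 \<le> x" "0 \<le> h" "h \<le> d"
  shows "weight1 N x \<le> 2 ^ N * (1 + d ^ N) * weight1 N (x + h)"
proof (cases "N = 0")
  case False
  have "(x + h) ^ N \<le> (2 * max x d) ^ N"
    using assms by (intro power_mono) auto
  also have "\<dots> \<le> 2 ^ N * (x ^ N + d ^ N)"
    using assms by (auto simp: power_mult_distrib max_def)
  moreover have "(1::real) \<le> 2 ^ N"
    by simp
  ultimately have "1 + (x + h) ^ N \<le> 2 ^ N * (1 + x ^ N + d ^ N)"
    unfolding distrib_left by linarith
  also have "\<dots> \<le> 2 ^ N * (1 + d ^ N) * (1 + x ^ N)"
    using assms by (simp add: algebra_simps)
  finally show ?thesis
    using False assms by (simp add: weight1_def field_simps add_pos_nonneg)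
qed (use assms in \<open>simp add: weight1_def\<close>)

section \<open>The modulus of continuity\<close>

text \<open>The triangle inequality leaves two values of \<open>f\<close>, and the shifted one is
  controlled by comparing weights. A single bound for all points and all shifts makes both the norm
  and the modulus suprema of bounded sets.\<close>

lemma weighted_shift_diff_bounded:
  assumes "f \<in> weighted_space N1 N2"
  obtains C where "\<And>x y h1 h2. \<lbrakk>0 \<le> x; 0 \<le> y; 0 \<le> h1; h1 \<le> d1; 0 \<le> h2; h2 \<le> d2\<rbrakk> \<Longrightarrow>
     weight N1 N2 (x, y) * \<bar>shift_diff h1 h2 f (x, y)\<bar> \<le> C"
proof -
  from assms obtain B where B: "\<And>p. p \<in> quadrant \<Longrightarrow> \<bar>weight N1 N2 p * f p\<bar> \<le> B"
    unfolding weighted_space_def bounded_iff by auto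
  define D where "D = (2 ^ N1 * (1 + d1 ^ N1)) * (2 ^ N2 * (1 + d2 ^ N2))"
  show thesis
  proof (rule that)
    fix x y h1 h2 :: real
    assume as: "0 \<le> x" "0 \<le> y" "0 \<le> h1" "h1 \<le> d1" "0 \<le> h2" "h2 \<le> d2"
    let ?w = "weight N1 N2 (x, y)" and ?w' = "weight N1 N2 (x + h1, y + h2)"
    have pos: "?w > 0" "?w' > 0"
      using as by (auto simp: weight_def weight1_pos)
    have D0: "D \<ge> 0"
      using as by (auto simp: D_def)
    have "?w \<le> D * ?w'"
      using mult_mono[OF weight1_shift_le[of x h1 d1 N1] weight1_shift_le[of y h2 d2 N2]] as
      by (simp add: weight_def D_def mult_ac weight1_pos less_imp_le)
    then have "?w * \<bar>f (x + h1, y + h2)\<bar> \<le> D * (?w' * \<bar>f (x + h1, y + h2)\<bar>)"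
      by (metis mult_right_mono abs_ge_zero mult.assoc)
    also have "\<dots> \<le> D * B"
      using B[of "(x + h1, y + h2)"] as D0 pos
      by (intro mult_left_mono) (auto simp: quadrant_def abs_mult)
    finally have "?w * \<bar>f (x + h1, y + h2)\<bar> \<le> D * B" .
    moreover have "?w * \<bar>f (x, y)\<bar> \<le> B"
      using B[of "(x, y)"] as pos by (auto simp: quadrant_def abs_mult)
    moreover have "?w * \<bar>f (x + h1, y + h2) - f (x, y)\<bar>
        \<le> ?w * (\<bar>f (x + h1, y + h2)\<bar> + \<bar>f (x, y)\<bar>)"
      using pos by (intro mult_left_mono) auto
    ultimately show "?w * \<bar>shift_diff h1 h2 f (x, y)\<bar> \<le> D * B + B"
      by (simp add: shift_diff_def distrib_left)
  qed
qed

lemma shift_diff_le_weighted_modulus: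
  assumes f: "f \<in> weighted_space N1 N2"
    and "0 \<le> x" "0 \<le> y" "0 \<le> h1" "h1 \<le> d1" "0 \<le> h2" "h2 \<le> d2"
  shows "weight N1 N2 (x, y) * \<bar>f (x + h1, y + h2) - f (x, y)\<bar> \<le> weighted_modulus N1 N2 f d1 d2"
proof -
  obtain C where C: "\<And>x y h1 h2. \<lbrakk>0 \<le> x; 0 \<le> y; 0 \<le> h1; h1 \<le> d1; 0 \<le> h2; h2 \<le> d2\<rbrakk> \<Longrightarrow>
     weight N1 N2 (x, y) * \<bar>shift_diff h1 h2 f (x, y)\<bar> \<le> C"
    using weighted_shift_diff_bounded[OF f, of d1 d2] by metis
  have ne: "quadrant \<noteq> {}"
    by (auto simp: quadrant_def)
  have "weight N1 N2 (x, y) * \<bar>shift_diff h1 h2 f (x, y)\<bar> \<le> weighted_norm N1 N2 (shift_diff h1 h2 f)"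
    unfolding weighted_norm_def using assms C[of _ _ h1 h2]
    by (intro cSUP_upper) (auto simp: quadrant_def intro!: bdd_aboveI[where M = C])
  also have "\<dots> \<le> weighted_modulus N1 N2 f d1 d2"
  proof -
    \<comment> \<open>The same \<open>C\<close> bounds the norms for all admissible shifts, so the
      outer supremum is bounded above as well.\<close>
    have "weighted_norm N1 N2 (shift_diff g1 g2 f) \<le> C"
      if "0 \<le> g1" "g1 \<le> d1" "0 \<le> g2" "g2 \<le> d2" for g1 g2
      unfolding weighted_norm_def using C that
      by (intro cSUP_least[OF ne]) (auto simp: quadrant_def)
    then have "bdd_above ((\<lambda>(h1, h2). weighted_norm N1 N2 (shift_diff h1 h2 f)) ` ({0..d1} \<times> {0..d2}))"
      by (auto intro!: bdd_aboveI[where M = C])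
    from cSUP_upper[OF _ this, of "(h1, h2)"] show ?thesis
      unfolding weighted_modulus_def using assms by auto
  qed
  finally show ?thesis
    by (simp add: shift_diff_def)
qed

section \<open>From short steps to arbitrary increments\<close>

lemma diff_le_of_small_steps:
  fixes g W :: "real \<Rightarrow> real"
  assumes step: "\<And>x h. \<lbrakk>0 \<le> x; 0 \<le> h; h \<le> \<delta>\<rbrakk> \<Longrightarrow> \<bar>g (x + h) - g x\<bar> \<le> D * W x"
    and mono: "\<And>x y. \<lbrakk>0 \<le> x; x \<le> y\<rbrakk> \<Longrightarrow> W x \<le> W y" and pos: "\<And>x. 0 \<le> x \<Longrightarrow> 0 \<le> W x"
    and "D \<ge> 0" "\<delta> > 0" "s \<ge> 0" "x \<ge> 0"
  shows "\<bar>g s - g x\<bar> \<le> (1 + \<bar>s - x\<bar> / \<delta>) * (D * W (max s x))"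
proof -
  \<comment> \<open>The weight sits at the current end of the walk; since \<open>W\<close> is
    nondecreasing, every earlier step may be charged at the price of the last one.\<close>
  have chain: "\<bar>g (x + real K * h) - g x\<bar> \<le> real K * (D * W (x + real K * h))"
    if "0 \<le> x" "0 \<le> h" "h \<le> \<delta>" for K x h
  proof (induction K)
    case (Suc K)
    have eq: "x + real (Suc K) * h = (x + real K * h) + h"
      by (simp add: algebra_simps)
    have m: "D * W (x + real K * h) \<le> D * W (x + real (Suc K) * h)"
      using that assms(4) by (intro mult_left_mono mono) (auto simp: algebra_simps)
    have "\<bar>g (x + real (Suc K) * h) - g (x + real K * h)\<bar> \<le> D * W (x + real K * h)"
      unfolding eq using that by (intro step) auto
    moreover have "real K * (D * W (x + real K * h)) \<le> real K * (D * W (x + real (Suc K) * h))"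
      by (rule mult_left_mono[OF m]) simp
    ultimately show ?case
      using Suc.IH m by (simp add: distrib_right)
  qed simp
  have ord: "\<bar>g s - g x\<bar> \<le> (1 + (s - x) / \<delta>) * (D * W s)" if "0 \<le> x" "x \<le> s" for s x
  proof (cases "x = s")
    case True
    then show ?thesis using pos[of s] that \<open>D \<ge> 0\<close> by simp
  next
    case False
    \<comment> \<open>The least number of equal steps of length at most \<delta>; rounding up
      accounts for the 1 in the factor \<open>1 + (s - x) / \<delta>\<close>. The case
      \<open>x = s\<close> is split off so that \<open>K\<close> is positive and can divide.\<close>
    define K where "K = nat \<lceil>(s - x) / \<delta>\<rceil>"
    have q: "(s - x) / \<delta> > 0"
      using False that \<open>\<delta> > 0\<close> by simp
    have K: "(s - x) / \<delta> \<le> real K" "real K \<le> 1 + (s - x) / \<delta>"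
      unfolding K_def using q by linarith+
    then have K0: "real K > 0"
      using q by linarith
    have "\<bar>g (x + real K * ((s - x) / K)) - g x\<bar> \<le> real K * (D * W (x + real K * ((s - x) / K)))"
      using that K K0 \<open>\<delta> > 0\<close> by (intro chain) (auto simp: field_simps)
    then have "\<bar>g s - g x\<bar> \<le> real K * (D * W s)"
      using K0 by simp
    also have "\<dots> \<le> (1 + (s - x) / \<delta>) * (D * W s)"
      using K pos[of s] that \<open>D \<ge> 0\<close> by (intro mult_right_mono) auto
    finally show ?thesis .
  qed
  \<comment> \<open>Only forward steps are controlled, so for \<open>s < x\<close> the walk runs
    from \<open>s\<close> to \<open>x\<close>; hence the weight at \<open>max s x\<close>.\<close>
  show ?thesis
  proof (cases "x \<le> s")
    case True
    then show ?thesis using ord[of x s] assms by (simp add: max_def)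
  next
    case False
    then show ?thesis using ord[of s x] assms by (simp add: max_def abs_minus_commute)
  qed
qed

text \<open>The share of one coordinate: a bound for the number of steps of length \<open>d\<close>,
  times the ratio of the weight at \<open>x\<close> to the weight at the farther right end of the
  walk.\<close>

definition step_weight :: "nat \<Rightarrow> real \<Rightarrow> real \<Rightarrow> real \<Rightarrow> real" where
  "step_weight N d x s = (1 + \<bar>s - x\<bar> / d) * (weight1 N x * inverse (weight1 N (max s x)))"

lemma step_weight_nonneg:
  assumes "x \<ge> 0" "d \<ge> 0"
  shows "step_weight N d x s \<ge> 0"
proof -
  have "weight1 N x > 0" "weight1 N (max s x) > 0"
    using assms by (simp_all add: weight1_pos le_max_iff_disj)
  then show ?thesis
    using assms by (simp add: step_weight_def)
qed

text \<open>The bound is a product of a function of \<open>s\<close> and a function of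
  \<open>t\<close> so that averages over the two variables separate.\<close>

lemma weight_diff_le_weighted_modulus:
  assumes f: "f \<in> weighted_space N1 N2"
    and "0 \<le> x" "0 \<le> y" "0 \<le> s" "0 \<le> t" "d1 > 0" "d2 > 0"
  shows "weight N1 N2 (x, y) * \<bar>f (s, t) - f (x, y)\<bar>
    \<le> 2 * weighted_modulus N1 N2 f d1 d2 * (step_weight N1 d1 x s * step_weight N2 d2 y t)"
proof -
  let ?om = "weighted_modulus N1 N2 f d1 d2"
  let ?W = "\<lambda>N x. inverse (weight1 N x)"
  \<comment> \<open>The zero shift at the origin already gives the value 0.\<close>
  have om: "?om \<ge> 0"
    using shift_diff_le_weighted_modulus[OF f, of 0 0 0 d1 0 d2] assms by simp
  have Wpos: "?W N u > 0" if "0 \<le> u" for N u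
    using weight1_pos[OF that] by simp
  have Wmono: "?W N u \<le> ?W N v" if "0 \<le> u" "u \<le> v" for N u v
    using weight1_antimono[OF that] weight1_pos[of v N] that by (intro le_imp_inverse_le) auto
  have step: "\<bar>f (u + h1, v + h2) - f (u, v)\<bar> \<le> ?om * (?W N1 u * ?W N2 v)"
    if "0 \<le> u" "0 \<le> v" "0 \<le> h1" "h1 \<le> d1" "0 \<le> h2" "h2 \<le> d2" for u v h1 h2
    using shift_diff_le_weighted_modulus[OF f that] weight1_pos[OF that(1), of N1]
      weight1_pos[OF that(2), of N2]
    by (simp add: weight_def field_simps)
  let ?a = "1 + \<bar>s - x\<bar> / d1" and ?b = "1 + \<bar>t - y\<bar> / d2"
  let ?P = "?W N1 (max s x)" and ?Q = "?W N2 (max t y)"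
  have "\<bar>f (s, y) - f (x, y)\<bar> \<le> ?a * (?om * ?W N2 y * ?W N1 (max s x))"
    using step[of _ y _ 0] assms om Wpos Wmono
    by (intro diff_le_of_small_steps[where g = "\<lambda>s. f (s, y)" and W = "?W N1"])
       (auto simp: mult_ac less_imp_le)
  \<comment> \<open>The weight at \<open>y\<close> is worsened to that at \<open>max t y\<close>, so
    that both legs of the route share one factor.\<close>
  also have "\<dots> \<le> ?a * (?om * ?Q * ?P)"
    using \<open>0 \<le> x\<close> \<open>0 \<le> y\<close> \<open>0 < d1\<close> om less_imp_le[OF Wpos[of "max s x" N1]]
    by (intro mult_left_mono mult_right_mono Wmono) auto
  finally have 1: "\<bar>f (s, y) - f (x, y)\<bar> \<le> ?a * (?om * ?Q * ?P)" .
  have "\<bar>f (s, t) - f (s, y)\<bar> \<le> ?b * (?om * ?W N1 s * ?W N2 (max t y))"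
    using step[of s _ 0] assms om Wpos Wmono
    by (intro diff_le_of_small_steps[where g = "\<lambda>t. f (s, t)" and W = "?W N2"])
       (auto simp: mult_ac less_imp_le)
  also have "\<dots> \<le> ?b * (?om * ?P * ?Q)"
    using \<open>0 \<le> s\<close> \<open>0 \<le> y\<close> \<open>0 < d2\<close> om less_imp_le[OF Wpos[of "max t y" N2]]
    by (intro mult_left_mono mult_right_mono Wmono) auto
  finally have "\<bar>f (s, t) - f (s, y)\<bar> \<le> ?b * (?om * ?P * ?Q)" .
  with 1 have "\<bar>f (s, y) - f (x, y)\<bar> + \<bar>f (s, t) - f (s, y)\<bar> \<le> (?a + ?b) * (?om * ?P * ?Q)"
    unfolding distrib_right[of ?a ?b] by (intro add_mono) (simp_all only: mult_ac)
  then have "\<bar>f (s, t) - f (x, y)\<bar> \<le> (?a + ?b) * (?om * ?P * ?Q)"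
    by linarith
  also have "\<dots> \<le> (2 * (?a * ?b)) * (?om * ?P * ?Q)"
  proof (rule mult_right_mono)
    \<comment> \<open>Both numbers are at least 1, so their sum is at most twice their product. This
      is the origin of the factor 2 in the conclusion.\<close>
    show "?a + ?b \<le> 2 * (?a * ?b)"
    proof -
      have "0 \<le> \<bar>s - x\<bar> / d1" "0 \<le> \<bar>t - y\<bar> / d2"
        using \<open>0 < d1\<close> \<open>0 < d2\<close> by simp_all
      moreover from this have "0 \<le> (\<bar>s - x\<bar> / d1) * (\<bar>t - y\<bar> / d2)"
        by (rule mult_nonneg_nonneg)
      ultimately show ?thesis
        unfolding distrib_left distrib_right by linarith
    qed
    show "0 \<le> ?om * ?P * ?Q"
      using om \<open>0 \<le> x\<close> \<open>0 \<le> y\<close>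
      by (intro mult_nonneg_nonneg less_imp_le[OF Wpos]) auto
  qed
  finally have "weight N1 N2 (x, y) * \<bar>f (s, t) - f (x, y)\<bar>
      \<le> weight N1 N2 (x, y) * ((2 * (?a * ?b)) * (?om * ?P * ?Q))"
    using assms by (intro mult_left_mono) (auto simp: weight_def weight1_pos less_imp_le)
  then show ?thesis
    by (simp add: step_weight_def weight_def mult_ac)
qed

text \<open>By AM-GM the product splits into squares whose Poisson averages are accessible. The
  weight ratio is 1 for \<open>s < x\<close>; otherwise its square is at most
  \<open>2 * (weight1 N x)\<^sup>2 * (1 + s ^ (2 * N))\<close>.\<close>

lemma step_weight_le:
  assumes "0 \<le> x" "0 \<le> s"
  shows "step_weight N d x s
    \<le> 2 + (s - x)\<^sup>2 / d\<^sup>2 + 2 * (weight1 N x)\<^sup>2 * (1 + s ^ (2 * N))"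
proof -
  let ?u = "\<bar>s - x\<bar> / d" and ?v = "weight1 N x * inverse (weight1 N (max s x))"
  have "?v\<^sup>2 \<le> 1 + 2 * (weight1 N x)\<^sup>2 * (1 + s ^ (2 * N))"
  proof (cases "x \<le> s")
    case True
    have "(inverse (weight1 N s))\<^sup>2 \<le> (1 + s ^ N)\<^sup>2"
      using assms inverse_weight1_le[of s N] weight1_pos[of s N] by (intro power_mono) auto
    also have "\<dots> \<le> 2 * (1 + s ^ (2 * N))"
      using sum_squares_bound[of 1 "s ^ N"]
      by (simp add: power2_sum power_mult mult.commute[of 2 N])
    finally have "(weight1 N x)\<^sup>2 * (inverse (weight1 N s))\<^sup>2
        \<le> (weight1 N x)\<^sup>2 * (2 * (1 + s ^ (2 * N)))"
      by (intro mult_left_mono) auto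
    then show ?thesis
      using True by (simp add: max_def power_mult_distrib) (simp add: algebra_simps)
  next
    case False
    then show ?thesis
      using weight1_pos[of x N] assms by (simp add: max_def)
  qed
  moreover have "2 * ((1 + ?u) * ?v) \<le> (1 + ?u)\<^sup>2 + ?v\<^sup>2"
    using sum_squares_bound[of "1 + ?u" ?v] by (simp only: mult.assoc)
  moreover have "(1 + ?u)\<^sup>2 \<le> 2 + 2 * ?u\<^sup>2"
    using sum_squares_bound[of 1 ?u] by (simp add: power2_sum)
  moreover have "?u\<^sup>2 = (s - x)\<^sup>2 / d\<^sup>2"
    by (simp add: power_divide)
  moreover have "0 \<le> (weight1 N x)\<^sup>2 * (1 + s ^ (2 * N))"
    using assms by (intro mult_nonneg_nonneg) (auto simp: add_nonneg_nonneg)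
  ultimately show ?thesis
    unfolding step_weight_def by linarith
qed

section \<open>Poisson moments\<close>

definition poisson :: "real \<Rightarrow> nat \<Rightarrow> real" where
  "poisson l k = exp (- l) * l ^ k / fact k"

lemma poisson_nonneg: "l \<ge> 0 \<Longrightarrow> poisson l k \<ge> 0"
  by (simp add: poisson_def)

lemma poisson_sums_1: "poisson l sums 1"
proof -
  have "(\<lambda>k. exp (- l) * (l ^ k /\<^sub>R fact k)) sums (exp (- l) * exp l)"
    by (intro sums_mult exp_converges)
  moreover have "exp (- l) * exp l = 1"
    by (simp flip: exp_add)
  ultimately show ?thesis
    by (simp add: poisson_def[abs_def] field_simps)
qed

text \<open>The source of all moments below: a factor \<open>Suc k\<close> is absorbed by an index
  shift, which lowers the order of the moment by one.\<close>

lemma poisson_Suc: "poisson l (Suc k) * real (Suc k) = l * poisson l k"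
  by (simp add: poisson_def divide_simps del: of_nat_Suc)

lemma poisson_mean: "(\<lambda>k. poisson l k * real k) sums l"
proof -
  have "(\<lambda>k. poisson l (Suc k) * real (Suc k)) sums (l * 1)"
    unfolding poisson_Suc by (intro sums_mult poisson_sums_1)
  \<comment> \<open>The term at \<open>k = 0\<close> vanishes, so the shifted series has the same
    sum.\<close>
  then show ?thesis by (subst (asm) sums_Suc_iff) simp
qed

lemma poisson_second_moment: "(\<lambda>k. poisson l k * (real k)\<^sup>2) sums (l\<^sup>2 + l)"
proof -
  have "(\<lambda>k. l * (poisson l k * real k + poisson l k)) sums (l * (l + 1))"
    by (intro sums_mult sums_add poisson_mean poisson_sums_1)
  moreover have "l * (poisson l k * real k + poisson l k) = poisson l (Suc k) * (real (Suc k))\<^sup>2" for k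
  proof -
    have "poisson l (Suc k) * (real (Suc k))\<^sup>2 = l * poisson l k * real (Suc k)"
      by (simp only: poisson_Suc[symmetric] power2_eq_square mult.assoc)
    then show ?thesis
      by (simp add: algebra_simps)
  qed
  ultimately have "(\<lambda>k. poisson l (Suc k) * (real (Suc k))\<^sup>2) sums (l * (l + 1))"
    by simp
  then show ?thesis
    by (subst (asm) sums_Suc_iff) (simp add: power2_eq_square algebra_simps)
qed

text \<open>Squared bias plus variance: the Poisson variance \<open>l\<close> is scaled by
  \<open>1 / m\<^sup>2\<close>.\<close>

lemma poisson_central_moment:
  "(\<lambda>k. poisson l k * (real k / m - x)\<^sup>2) sums ((l / m - x)\<^sup>2 + l / m\<^sup>2)"
proof -
  have "(\<lambda>k. poisson l k * (real k)\<^sup>2 * (1 / m\<^sup>2) + poisson l k * real k * (- 2 * x / m)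
            + poisson l k * x\<^sup>2)
      sums ((l\<^sup>2 + l) * (1 / m\<^sup>2) + l * (- 2 * x / m) + 1 * x\<^sup>2)"
    by (intro sums_add sums_mult2 poisson_sums_1 poisson_mean poisson_second_moment)
  moreover have "poisson l k * (real k)\<^sup>2 * (1 / m\<^sup>2) + poisson l k * real k * (- 2 * x / m)
            + poisson l k * x\<^sup>2 = poisson l k * (real k / m - x)\<^sup>2" for k
    by (simp add: power2_diff power_divide algebra_simps)
  moreover have "(l\<^sup>2 + l) * (1 / m\<^sup>2) + l * (- 2 * x / m) + 1 * x\<^sup>2 = (l / m - x)\<^sup>2 + l / m\<^sup>2"
    by (simp add: power2_diff power_divide add_divide_distrib algebra_simps)
  ultimately show ?thesis
    by simp
qed

text \<open>Induction on \<open>j\<close>: the index shift turns order \<open>Suc j\<close> into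
  \<open>l / m\<close>, at most \<open>x\<close>, times an average of
  \<open>((k + 1) / m) ^ j\<close>. As \<open>m \<ge> 1\<close>, the extra \<open>1 / m\<close> is
  at most 1, which keeps \<open>C\<close> independent of \<open>m\<close>.\<close>

lemma poisson_moment_bound:
  "\<exists>C\<ge>0. \<forall>m x l. m \<ge> 1 \<longrightarrow> 0 \<le> x \<longrightarrow> 0 \<le> l \<longrightarrow> l \<le> m * x \<longrightarrow>
     summable (\<lambda>k. poisson l k * (real k / m) ^ j) \<and>
     (\<Sum>k. poisson l k * (real k / m) ^ j) \<le> C * (1 + x ^ j)"
proof (induction j)
  case 0
  have "summable (poisson l)" "suminf (poisson l) = 1" for l
    using poisson_sums_1[of l] by (auto simp: sums_iff)
  then show ?case by (intro exI[of _ 1]) auto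
next
  case (Suc j)
  then obtain C where "C \<ge> 0" and C: "\<And>m x l. \<lbrakk>m \<ge> 1; 0 \<le> x; 0 \<le> l; l \<le> m * x\<rbrakk> \<Longrightarrow>
     summable (\<lambda>k. poisson l k * (real k / m) ^ j) \<and>
     (\<Sum>k. poisson l k * (real k / m) ^ j) \<le> C * (1 + x ^ j)"
    by blast
  show ?case
  proof (intro exI conjI allI impI)
    \<comment> \<open>The power of 2 comes from separating \<open>k / m + 1\<close>; the factor
      \<open>2 * C + 1\<close> comes from \<open>x \<le> 1 + x ^ Suc j\<close>, used once for each
      summand.\<close>
    show "0 \<le> 2 ^ j * (2 * C + 1)"
      using \<open>C \<ge> 0\<close> by simp
    fix m x l :: real
    assume as: "1 \<le> m" "0 \<le> x" "0 \<le> l" "l \<le> m * x"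
    let ?g = "\<lambda>k. poisson l k * (real k / m) ^ Suc j"
    let ?G = "\<lambda>k. (l / m) * 2 ^ j * (poisson l k * (real k / m) ^ j + poisson l k)"
    note Cm = C[OF as]
    have S: "?G sums ((l / m) * 2 ^ j * ((\<Sum>k. poisson l k * (real k / m) ^ j) + 1))"
      using Cm by (intro sums_mult sums_add poisson_sums_1 summable_sums) auto
    have le: "?g (Suc k) \<le> ?G k" for k
    proof -
      have "?g (Suc k) = (poisson l (Suc k) * real (Suc k)) / m * (real (Suc k) / m) ^ j"
        by simp
      also have "\<dots> = (l / m * poisson l k) * (real (Suc k) / m) ^ j"
        by (simp only: poisson_Suc) simp
      also have "\<dots> \<le> (l / m * poisson l k) * (2 ^ j * ((real k / m) ^ j + 1))"
      proof (intro mult_left_mono)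
        have "real (Suc k) / m \<le> real k / m + 1"
          using as by (simp add: field_simps)
        also have "\<dots> \<le> 2 * max (real k / m) 1"
          by simp
        finally have "(real (Suc k) / m) ^ j \<le> (2 * max (real k / m) 1) ^ j"
          using as by (intro power_mono) auto
        also have "\<dots> \<le> 2 ^ j * ((real k / m) ^ j + 1)"
          using as by (auto simp: power_mult_distrib max_def)
        finally show "(real (Suc k) / m) ^ j \<le> 2 ^ j * ((real k / m) ^ j + 1)" .
        show "0 \<le> l / m * poisson l k"
          using as by (simp add: poisson_nonneg)
      qed
      finally show ?thesis by (simp add: algebra_simps)
    qed
    have nn: "?g k \<ge> 0" for k
      using as by (simp add: poisson_nonneg)
    have sS: "summable (\<lambda>k. ?g (Suc k))"
    proof (rule summable_comparison_test[OF _ sums_summable[OF S]], intro exI allI impI)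
      show "norm (?g (Suc k)) \<le> ?G k" for k
        using le[of k] nn[of "Suc k"] by (simp only: real_norm_def abs_of_nonneg)
    qed
    then show s: "summable ?g"
      by (subst (asm) summable_Suc_iff)
    \<comment> \<open>The exponent \<open>Suc j\<close> is positive, so the split-off term at 0 is
      zero.\<close>
    have "suminf ?g = (\<Sum>k. ?g (Suc k))"
      using suminf_split_head[OF s] by simp
    also have "\<dots> \<le> suminf ?G"
      by (rule suminf_le[OF le sS sums_summable[OF S]])
    also have "\<dots> = (l / m) * 2 ^ j * ((\<Sum>k. poisson l k * (real k / m) ^ j) + 1)"
      by (rule sums_unique[OF S, symmetric])
    also have "\<dots> \<le> x * 2 ^ j * (C * (1 + x ^ j) + 1)"
    proof (intro mult_mono)
      show "l / m \<le> x" using as by (simp add: field_simps)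
      have "0 \<le> (\<Sum>k. poisson l k * (real k / m) ^ j)"
        using Cm as by (intro suminf_nonneg) (auto simp: poisson_nonneg)
      then show "0 \<le> (\<Sum>k. poisson l k * (real k / m) ^ j) + 1" by simp
    qed (use Cm as in auto)
    also have "\<dots> = 2 ^ j * (C * (x + x ^ Suc j) + x)"
      by (simp add: algebra_simps)
    also have "\<dots> \<le> 2 ^ j * (C * (2 * (1 + x ^ Suc j)) + (1 + x ^ Suc j))"
    proof -
      have x: "x \<le> 1 + x ^ Suc j"
      proof (cases "x \<le> 1")
        case True
        moreover have "0 \<le> x ^ Suc j"
          using as by (intro zero_le_power) auto
        ultimately show ?thesis by linarith
      next
        case False
        then have "x \<le> x ^ Suc j"
          by (intro self_le_power) auto
        then show ?thesis by linarith
      qed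
      then have "C * (x + x ^ Suc j) \<le> C * (2 * (1 + x ^ Suc j))"
        using \<open>C \<ge> 0\<close> by (intro mult_left_mono) auto
      with x show ?thesis
        by (intro mult_left_mono[OF add_mono]) auto
    qed
    also have "\<dots> = 2 ^ j * (2 * C + 1) * (1 + x ^ Suc j)"
      by (simp add: algebra_simps)
    finally show "suminf ?g \<le> 2 ^ j * (2 * C + 1) * (1 + x ^ Suc j)" .
  qed
qed

section \<open>The operator\<close>

definition Y_mean :: "real \<Rightarrow> nat \<Rightarrow> real \<Rightarrow> real" where
  "Y_mean a m x = x * ln a / (a powr (1 / real m) - 1)"

lemma Y_op_eq_poisson:
  assumes "a > 1"
  shows "Y_op m n a f (x, y) = (\<Sum>k1. \<Sum>k2. poisson (Y_mean a m x) k1 * poisson (Y_mean a n y) k2 *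
           f (real k1 / real m, real k2 / real n))"
proof -
  \<comment> \<open>The prefactor becomes \<open>exp (- l)\<close>, the normalisation of the Poisson
    law with mean \<open>Y_mean\<close>.\<close>
  have "a powr (- x / q) = exp (- (x * ln a / q))" for x q
    using assms by (simp add: powr_def)
  then show ?thesis
    unfolding Y_op_def poisson_def Y_mean_def
    by (simp add: power_divide power_mult_distrib power_add mult_ac)
qed

text \<open>With \<open>u = ln a / m\<close> the mean divided by \<open>m\<close> is
  \<open>x * (u / (exp u - 1))\<close>, and this quotient lies between \<open>1 - u\<close> and 1.
  Both sides follow from \<open>1 + t \<le> exp t\<close>, at \<open>t = u\<close> and
  \<open>t = - u\<close>.\<close>

lemma Y_mean_bounds:
  assumes "a > 1" "m \<ge> 1" "x \<ge> 0"
  shows "0 \<le> Y_mean a m x" "Y_mean a m x \<le> real m * x"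
    "x - Y_mean a m x / real m \<le> x * ln a / real m"
proof -
  define u where "u = ln a / real m"
  have u: "u > 0"
    using assms by (simp add: u_def)
  have a: "a powr (1 / real m) = exp u"
    using assms by (simp add: powr_def u_def)
  have e: "exp u - 1 > 0" "u \<le> exp u - 1"
    using u exp_ge_add_one_self[of u] by (simp, linarith)
  have "1 - u \<le> exp (- u)"
    using exp_ge_add_one_self[of "- u"] by simp
  then have "exp u * (1 - u) \<le> 1"
    by (simp add: exp_minus field_simps)
  then have "1 - u \<le> u / (exp u - 1)"
    using e by (simp add: field_simps)
  moreover have "u / (exp u - 1) \<le> 1"
    using e by simp
  moreover have Y: "Y_mean a m x = real m * (x * (u / (exp u - 1)))"
    using assms by (simp add: Y_mean_def a u_def)
  ultimately show "Y_mean a m x \<le> real m * x"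
    using assms by (simp only: mult_left_le mult_left_mono of_nat_0_le_iff)
  show "0 \<le> Y_mean a m x"
    unfolding Y using u e assms by simp
  have "x * (1 - u) \<le> x * (u / (exp u - 1))"
    using \<open>1 - u \<le> u / (exp u - 1)\<close> assms by (intro mult_left_mono)
  moreover have "Y_mean a m x / real m = x * (u / (exp u - 1))"
    unfolding Y using assms by simp
  moreover have "x * (1 - u) = x - x * ln a / real m"
    by (simp add: u_def algebra_simps)
  ultimately show "x - Y_mean a m x / real m \<le> x * ln a / real m"
    by linarith
qed

text \<open>The two parts of \<open>x * (1 + x) / m\<close> have separate duties:
  \<open>x / m\<close> dominates the variance, and \<open>x\<^sup>2 / m\<close> dominates the
  squared bias up to \<open>(ln a)\<^sup>2\<close>.\<close>

lemma Y_mean_central_moment_le: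
  assumes "a > 1" "m \<ge> 1" "x \<ge> 0"
  shows "(Y_mean a m x / real m - x)\<^sup>2 + Y_mean a m x / (real m)\<^sup>2
    \<le> (1 + (ln a)\<^sup>2) * (delta' m x)\<^sup>2"
proof -
  note b = Y_mean_bounds[OF assms]
  have m: "real m \<ge> 1" using assms by simp
  have le: "Y_mean a m x / real m \<le> x"
    using b m by (simp add: field_simps)
  have "(Y_mean a m x / real m - x)\<^sup>2 \<le> (x * ln a / real m)\<^sup>2"
    using b(3) le by (simp add: power2_commute[of _ x] power_mono)
  also have "\<dots> = (ln a)\<^sup>2 * (x\<^sup>2 / (real m)\<^sup>2)"
    by (simp add: power_mult_distrib power_divide)
  also have "\<dots> \<le> (ln a)\<^sup>2 * (x\<^sup>2 / real m)"
    using m by (intro mult_left_mono divide_left_mono) (auto simp: self_le_power)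
  also have "\<dots> \<le> (ln a)\<^sup>2 * (delta' m x)\<^sup>2"
    using assms m by (intro mult_left_mono)
      (auto simp: delta'_def power2_eq_square algebra_simps divide_right_mono)
  finally have 1: "(Y_mean a m x / real m - x)\<^sup>2 \<le> (ln a)\<^sup>2 * (delta' m x)\<^sup>2" .
  have "Y_mean a m x / (real m)\<^sup>2 = (Y_mean a m x / real m) / real m"
    by (simp add: power2_eq_square)
  also have "\<dots> \<le> x / real m"
    using le by (intro divide_right_mono) auto
  also have "\<dots> \<le> (delta' m x)\<^sup>2"
    using assms m by (auto simp: delta'_def algebra_simps divide_right_mono)
  finally show ?thesis
    using 1 by (simp add: algebra_simps)
qed

text \<open>Up to a constant, \<open>delta'\<close> dominates the root mean square distance of
  \<open>k / m\<close> from \<open>x\<close>, so the squared number of steps has bounded average.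
  The growth of the other moment is absorbed by the squared weight at \<open>x\<close>.\<close>

lemma poisson_step_weight_bound:
  assumes "a > 1"
  shows "\<exists>C>0. \<forall>m\<ge>1. \<forall>x>0.
     summable (\<lambda>k. poisson (Y_mean a m x) k * step_weight N (delta' m x) x (real k / real m)) \<and>
     (\<Sum>k. poisson (Y_mean a m x) k * step_weight N (delta' m x) x (real k / real m)) \<le> C"
proof -
  obtain C where "C \<ge> 0" and C: "\<And>m x l. \<lbrakk>m \<ge> 1; 0 \<le> x; 0 \<le> l; l \<le> m * x\<rbrakk> \<Longrightarrow>
     summable (\<lambda>k. poisson l k * (real k / m) ^ (2 * N)) \<and>
     (\<Sum>k. poisson l k * (real k / m) ^ (2 * N)) \<le> C * (1 + x ^ (2 * N))"
    using poisson_moment_bound[of "2 * N"] by blast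
  show ?thesis
  \<comment> \<open>The summands bound the averages of the three terms of
    \<open>step_weight_le\<close>: the constant 2, the squared distance over \<open>delta'\<close>
    squared, and the weighted power.\<close>
  proof (intro exI[of _ "2 + (1 + (ln a)\<^sup>2) + 4 * (1 + C)"] conjI allI impI)
    show "0 < 2 + (1 + (ln a)\<^sup>2) + 4 * (1 + C)"
      using \<open>C \<ge> 0\<close> by (intro add_pos_nonneg) auto
    fix m :: nat and x :: real
    assume as: "1 \<le> m" "0 < x"
    let ?d = "delta' m x"
    define l where "l = Y_mean a m x"
    define w where "w = weight1 N x"
    define S where "S = (\<Sum>k. poisson l k * (real k / m) ^ (2 * N))"
    define T where "T = (l / m - x)\<^sup>2 + l / (real m)\<^sup>2"
    define F where "F = (\<lambda>k. poisson l k * step_weight N ?d x (real k / real m))"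
    have l: "0 \<le> l" "l \<le> real m * x"
      using Y_mean_bounds[OF assms as(1), of x] as by (auto simp: l_def)
    have d: "?d > 0"
      using as by (simp add: delta'_def)
    have SC: "summable (\<lambda>k. poisson l k * (real k / m) ^ (2 * N))" "S \<le> C * (1 + x ^ (2 * N))"
      using C[of "real m" x l] as l by (auto simp: S_def)
    define G where "G = (\<lambda>k. poisson l k * 2 + poisson l k * (real k / m - x)\<^sup>2 * (1 / ?d\<^sup>2)
        + (2 * w\<^sup>2) * (poisson l k + poisson l k * (real k / m) ^ (2 * N)))"
    have G: "G sums (1 * 2 + T * (1 / ?d\<^sup>2) + (2 * w\<^sup>2) * (1 + S))"
      unfolding G_def S_def T_def using SC as
      by (intro sums_add sums_mult sums_mult2 poisson_sums_1 poisson_central_moment summable_sums) auto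
    have F0: "F k \<ge> 0" for k
      unfolding F_def using l d as
      by (intro mult_nonneg_nonneg poisson_nonneg step_weight_nonneg) auto
    have FG: "F k \<le> G k" for k
    proof -
      have "F k \<le> poisson l k * (2 + (real k / m - x)\<^sup>2 / ?d\<^sup>2 + 2 * w\<^sup>2 * (1 + (real k / m) ^ (2 * N)))"
        unfolding F_def w_def using as l
        by (intro mult_left_mono step_weight_le poisson_nonneg) auto
      also have "\<dots> = G k"
        by (simp add: G_def algebra_simps)
      finally show ?thesis .
    qed
    have sF: "summable F"
      by (rule summable_comparison_test[OF _ sums_summable[OF G]]) (use FG F0 in auto)
    have "suminf F \<le> suminf G"
      by (rule suminf_le[OF FG sF sums_summable[OF G]])
    also have "\<dots> = 2 + T / ?d\<^sup>2 + 2 * w\<^sup>2 * (1 + S)"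
      using sums_unique[OF G] by simp
    also have "\<dots> \<le> 2 + (1 + (ln a)\<^sup>2) + 4 * (1 + C)"
    proof -
      have "T \<le> (1 + (ln a)\<^sup>2) * ?d\<^sup>2"
        using Y_mean_central_moment_le[OF assms as(1), of x] as by (simp add: T_def l_def)
      then have "T / ?d\<^sup>2 \<le> 1 + (ln a)\<^sup>2"
        using d by (simp add: pos_divide_le_eq)
      moreover have "2 * w\<^sup>2 * (1 + S) \<le> 4 * (1 + C)"
      proof -
        have "1 + S \<le> (1 + C) * (1 + x ^ (2 * N))"
        proof -
          have "0 \<le> x ^ (2 * N)"
            using as by simp
          then show ?thesis
            using SC(2) unfolding distrib_right mult_1_left by linarith
        qed
        then have "2 * w\<^sup>2 * (1 + S) \<le> 2 * w\<^sup>2 * ((1 + C) * (1 + x ^ (2 * N)))"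
          by (intro mult_left_mono) auto
        also have "\<dots> = (2 * (1 + C)) * (w\<^sup>2 * (1 + x ^ (2 * N)))"
          by simp
        also have "\<dots> \<le> (2 * (1 + C)) * 2"
          unfolding w_def using as \<open>C \<ge> 0\<close> by (intro mult_left_mono weight1_sq_le) auto
        finally show ?thesis by simp
      qed
      ultimately show ?thesis by linarith
    qed
    finally have "suminf F \<le> 2 + (1 + (ln a)\<^sup>2) + 4 * (1 + C)" .
    with sF show "summable (\<lambda>k. poisson (Y_mean a m x) k * step_weight N ?d x (real k / real m))"
      "(\<Sum>k. poisson (Y_mean a m x) k * step_weight N ?d x (real k / real m))
        \<le> 2 + (1 + (ln a)\<^sup>2) + 4 * (1 + C)"
      by (simp_all add: F_def l_def)
  qed
qed

section \<open>Averaging against a product of two probability laws\<close>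

lemma double_average_diff_le:
  fixes p q A B :: "nat \<Rightarrow> real" and F :: "nat \<Rightarrow> nat \<Rightarrow> real"
  assumes p: "p sums 1" and q: "q sums 1" and pq: "\<And>i. p i \<ge> 0" "\<And>j. q j \<ge> 0"
    and A: "summable (\<lambda>i. p i * A i)" and B: "summable (\<lambda>j. q j * B j)"
    and F: "\<And>i j. \<bar>F i j - c\<bar> \<le> A i * B j"
  shows "\<bar>(\<Sum>i. \<Sum>j. p i * q j * F i j) - c\<bar> \<le> (\<Sum>i. p i * A i) * (\<Sum>j. q j * B j)"
proof -
  \<comment> \<open>Both laws have total mass 1, so \<open>c\<close> may be moved inside. The inner
    averages of \<open>F - c\<close> converge absolutely by the product majorant.\<close>
  define I where "I i = (\<Sum>j. p i * q j * (F i j - c))" for i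
  have le: "\<bar>p i * q j * (F i j - c)\<bar> \<le> p i * A i * (q j * B j)" for i j
    using mult_left_mono[OF F[of i j], of "p i * q j"] pq by (simp add: abs_mult mult_ac)
  have sle: "summable (\<lambda>j. p i * A i * (q j * B j))" for i
    by (intro summable_mult B)
  have sabs: "summable (\<lambda>j. \<bar>p i * q j * (F i j - c)\<bar>)" for i
    by (rule summable_comparison_test[OF _ sle[of i]]) (use le in auto)
  then have s: "summable (\<lambda>j. p i * q j * (F i j - c))" for i
    by (rule summable_rabs_cancel)
  \<comment> \<open>Convergence of the inner series for \<open>F\<close> itself is recovered by
    adding back the summable constant part.\<close>
  have inner: "(\<Sum>j. p i * q j * F i j) = I i + p i * c" for i
  proof -
    have "(\<lambda>j. p i * q j * (F i j - c) + p i * c * q j) sums (I i + p i * c * 1)"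
      unfolding I_def by (intro sums_add sums_mult summable_sums s q)
    then show ?thesis
      by (simp add: sums_iff algebra_simps)
  qed
  have Ile: "\<bar>I i\<bar> \<le> p i * A i * (\<Sum>j. q j * B j)" for i
  proof -
    have "\<bar>I i\<bar> \<le> (\<Sum>j. \<bar>p i * q j * (F i j - c)\<bar>)"
      unfolding I_def by (rule summable_rabs[OF sabs])
    also have "\<dots> \<le> (\<Sum>j. p i * A i * (q j * B j))"
      by (rule suminf_le[OF le sabs sle])
    also have "\<dots> = p i * A i * (\<Sum>j. q j * B j)"
      by (rule suminf_mult[OF B])
    finally show ?thesis .
  qed
  have sA: "summable (\<lambda>i. p i * A i * (\<Sum>j. q j * B j))"
    by (intro summable_mult2 A)
  have sIabs: "summable (\<lambda>i. \<bar>I i\<bar>)"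
    by (rule summable_comparison_test[OF _ sA]) (use Ile in auto)
  have "(\<lambda>i. I i + p i * c) sums (suminf I + 1 * c)"
    by (intro sums_add sums_mult2 p summable_sums summable_rabs_cancel[OF sIabs])
  then have "(\<Sum>i. \<Sum>j. p i * q j * F i j) - c = suminf I"
    by (simp add: inner sums_iff)
  also have "\<bar>\<dots>\<bar> \<le> (\<Sum>i. \<bar>I i\<bar>)"
    by (rule summable_rabs[OF sIabs])
  also have "\<dots> \<le> (\<Sum>i. p i * A i * (\<Sum>j. q j * B j))"
    by (rule suminf_le[OF Ile sIabs sA])
  also have "\<dots> = (\<Sum>i. p i * A i) * (\<Sum>j. q j * B j)"
    by (rule suminf_mult2[OF A, symmetric])
  finally show ?thesis .
qed

text \<open>The estimate is pointwise because \<open>delta'\<close> varies with the point. The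
  constant is uniform in \<open>f\<close>, \<open>m\<close>, \<open>n\<close>, \<open>x\<close> and
  \<open>y\<close>; it is chosen after \<open>a\<close>, since \<open>ln a\<close> enters through
  the bias of the Poisson mean.\<close>

theorem theorem3p2:
  fixes a :: real and N1 N2 :: nat
  assumes "a > 1"
  shows "\<exists>M9>0. \<forall>f\<in>weighted_space N1 N2. \<forall>m\<ge>1. \<forall>n\<ge>1. \<forall>x>0. \<forall>y>0.
           weight N1 N2 (x, y) * \<bar>Y_op m n a f (x, y) - f (x, y)\<bar>
             \<le> M9 * weighted_modulus N1 N2 f (delta' m x) (delta' n y)"
proof -
  let ?P = "\<lambda>N C. \<forall>m\<ge>1. \<forall>x>0.
      summable (\<lambda>k. poisson (Y_mean a m x) k * step_weight N (delta' m x) x (real k / real m)) \<and>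
      (\<Sum>k. poisson (Y_mean a m x) k * step_weight N (delta' m x) x (real k / real m)) \<le> C"
  obtain C1 where C1: "C1 > 0 \<and> ?P N1 C1"
    using poisson_step_weight_bound[OF assms] by (rule exE)
  obtain C2 where C2: "C2 > 0 \<and> ?P N2 C2"
    using poisson_step_weight_bound[OF assms] by (rule exE)
  have C0: "C1 > 0" "C2 > 0"
    using C1 C2 by simp_all
  show ?thesis
  \<comment> \<open>The 2 comes from joining the two legs of the route; \<open>C1\<close> and
    \<open>C2\<close> bound the averaged step factors of the two coordinates.\<close>
  proof (intro exI[of _ "2 * (C1 * C2)"] conjI ballI allI impI)
    show "0 < 2 * (C1 * C2)"
      using C0 by simp
    fix f and m n :: nat and x y :: real
    assume f: "f \<in> weighted_space N1 N2" and as: "1 \<le> m" "1 \<le> n" "0 < x" "0 < y"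
    let ?om = "weighted_modulus N1 N2 f (delta' m x) (delta' n y)"
    let ?w = "weight N1 N2 (x, y)"
    let ?l = "Y_mean a m x" and ?k = "Y_mean a n y"
    let ?A = "\<lambda>i. step_weight N1 (delta' m x) x (real i / real m)"
    let ?B = "\<lambda>j. step_weight N2 (delta' n y) y (real j / real n)"
    have d: "delta' m x > 0" "delta' n y > 0"
      using as by (simp_all add: delta'_def)
    have w: "?w > 0"
      using as by (simp add: weight_def weight1_pos)
    have om: "?om \<ge> 0"
      using shift_diff_le_weighted_modulus[OF f, of 0 0 0 "delta' m x" 0 "delta' n y"] d by simp
    have l: "?l \<ge> 0" "?k \<ge> 0"
      using Y_mean_bounds(1)[OF assms] as by simp_all
    have S1: "summable (\<lambda>i. poisson ?l i * ?A i)" "(\<Sum>i. poisson ?l i * ?A i) \<le> C1"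
      using C1 as by simp_all
    have S2: "summable (\<lambda>j. poisson ?k j * ?B j)" "(\<Sum>j. poisson ?k j * ?B j) \<le> C2"
      using C2 as by simp_all
    \<comment> \<open>The factor \<open>2 * ?om / ?w\<close> does not depend on the summation
      indices; it is attached to the first coordinate to give the bound the required product
      form.\<close>
    have "\<bar>Y_op m n a f (x, y) - f (x, y)\<bar>
        \<le> (\<Sum>i. poisson ?l i * (2 * ?om / ?w * ?A i)) * (\<Sum>j. poisson ?k j * ?B j)"
      unfolding Y_op_eq_poisson[OF assms]
    proof (rule double_average_diff_le[OF poisson_sums_1 poisson_sums_1])
      show "poisson ?l i \<ge> 0" "poisson ?k i \<ge> 0" for i
        using l by (simp_all add: poisson_nonneg)
      have "summable (\<lambda>i. 2 * ?om / ?w * (poisson ?l i * ?A i))"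
        by (intro summable_mult S1)
      then show "summable (\<lambda>i. poisson ?l i * (2 * ?om / ?w * ?A i))"
        by (simp only: mult.left_commute)
      show "summable (\<lambda>j. poisson ?k j * ?B j)"
        by (rule S2)
      show "\<bar>f (real i / real m, real j / real n) - f (x, y)\<bar> \<le> 2 * ?om / ?w * ?A i * ?B j" for i j
      proof -
        have "?w * \<bar>f (real i / real m, real j / real n) - f (x, y)\<bar> \<le> 2 * ?om * (?A i * ?B j)"
          using as by (intro weight_diff_le_weighted_modulus f d) auto
        then show ?thesis
          using w by (simp add: pos_le_divide_eq mult_ac)
      qed
    qed
    also have "(\<Sum>i. poisson ?l i * (2 * ?om / ?w * ?A i)) =
        2 * ?om / ?w * (\<Sum>i. poisson ?l i * ?A i)"
      using suminf_mult[OF S1(1), of "2 * ?om / ?w"] by (simp only: mult.left_commute)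
    also have "2 * ?om / ?w * (\<Sum>i. poisson ?l i * ?A i) * (\<Sum>j. poisson ?k j * ?B j)
        \<le> 2 * ?om / ?w * C1 * C2"
    proof (intro mult_mono mult_left_mono mult_nonneg_nonneg)
      show "0 \<le> (\<Sum>i. poisson ?l i * ?A i)" "0 \<le> (\<Sum>j. poisson ?k j * ?B j)"
        using S1 S2 as l d by (auto intro!: suminf_nonneg mult_nonneg_nonneg poisson_nonneg step_weight_nonneg)
    qed (use S1 S2 om w C0 in auto)
    finally have "?w * \<bar>Y_op m n a f (x, y) - f (x, y)\<bar> \<le> ?w * (2 * ?om / ?w * C1 * C2)"
      using w by (intro mult_left_mono) auto
    then show "?w * \<bar>Y_op m n a f (x, y) - f (x, y)\<bar> \<le> 2 * (C1 * C2) * ?om"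
      using w by (simp add: mult_ac)
  qed
qed

end
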